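(* Let $r,T$ be positive integers, let $C$ be an $r\times r$ involutory permutation matrix, and let $\mathcal{I}=\mathcal{I}_{ABC}$ be an index coding (IC) problem over $\mathbb{F}_q$ on $rT$ messages with blocks $\mathcal{I}_1,\dots,\mathcal{I}_T$, satisfying the $Type_A$, $Type_B$, $Type_C$ properties listed in the context, with $L\times rT$ fitting matrix $F_X$. Let $G$ be its $r\times rT$ index code given by $$G^{\mathcal{I}_i}=\begin{cases} I, & \text{if } \mathcal{I}_i\in Type_A,\\ C, & \text{if } \mathcal{I}_i\in Type_B,\\ I+C-C_1, & \text{if } \mathcal{I}_i\in Type_C,\end{cases}$$ where $G^{\mathcal{I}_i}$ is the $r\times r$ submatrix of $G$ on the columns indexed by $\mathcal{I}_i$, and $C_1$ is the $r\times r$ matrix whose $i$-th column equals the $i$-th column of $I$ for each fixed point $i$ of $\sigma_C$, and whose other columns are zero. Let $B_X^X$ be the $L\times rT$ matrix obtained from $F_X$ by permuting the columns in each $\mathcal{I}_i$ ($i\in\{1,\dots,T\}$) according to $\sigma_C$ and then replacing all $1$s by $X$s. Then $(G~~CG)$ is an index code for the extended IC problem $\mathcal{I}_{ext}$ with fitting matrix $$\begin{pmatrix}F_X & B_X^X\\ B_X^X & F_X\end{pmatrix}.$$ Furthermore, if $G$ is optimal for $\mathcal{I}$, then $(G~~CG)$ is an optimal code for $\mathcal{I}_{ext}$ and $\mathcal{I}_{ext}$ is a rank-invariant $2$-order extension of $\mathcal{I}$.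
   Context: Fix a finite field $\mathbb{F}_q$. A fitting matrix $F_X$ of size $L\times K$ ($L\ge K$) is a matrix with entries in the symbol set $\{0,1,X\}$ such that each row contains exactly one $1$ (its other entries being $0$s and $X$s), and for every column $k$ there is at least one row having its $1$ in position $k$. It defines an IC problem with $K$ messages, with symbols $x_1,\dots,x_K\in\mathbb{F}_q$, and $L$ receivers, one per row: the receiver $t$ of a row demands the message $k$ where the row has its $1$, and its side-information set $S(t)$ is exactly the set of messages at whose positions the row has an $X$. A (scalar linear) index code of length $r$ for the problem is an $r\times K$ matrix $G$ over $\mathbb{F}_q$ such that, when $G\boldsymbol{x}$ is broadcast for $\boldsymbol{x}=(x_1,\dots,x_K)^T\in\mathbb{F}_q^K$, every receiver can recover its demanded symbol from $G\boldsymbol{x}$ and its side-information symbols (for all $\boldsymbol{x}$). The code is optimal if its length $r$ is the minimum possible among all such codes for the problem. $minrk(F_X)$ is the minimum rank over $\mathbb{F}_q$ of the matrices obtained from $F_X$ by replacing each $X$ by an arbitrary element of $\mathbb{F}_q$ (independently for each position; the $0$s and $1$s are kept). It is a known fact that the optimal length of a scalar linear index code equals $minrk(F_X)$. An IC problem $\mathcal{I}_{ext}$ with fitting matrix $F_{ext,X}$ is an extension of $\mathcal{I}$ (with $L\times K$ fitting matrix $F_X$) if $F_X$ is a submatrix of $F_{ext,X}$; it is a $2$-order extension if $F_{ext,X}$ is $2L\times 2K$. The extension is rank-invariant if the optimal code lengths are equal, i.e. $minrk(F_{ext,X})=minrk(F_X)$. An involutory permutation matrix is a permutation matrix $C$ with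 $C^2=I$ (hence $C=C^T$). $\sigma_C$ denotes the corresponding permutation of $\{1,\dots,r\}$ (pre-multiplication by $C$ moves row $k$ to row $\sigma_C(k)$; post-multiplication moves column $k$ to column $\sigma_C(k)$). Its cycles have length $1$ (fixed points) or $2$ (swaps $(k,\sigma_C(k))$). The problem $\mathcal{I}_{ABC}$: it has $rT$ messages, divided into $T$ disjoint blocks $\mathcal{I}_1,\dots,\mathcal{I}_T\subseteq\{1,\dots,rT\}$ of $r$ messages each; the messages of block $\mathcal{I}_i$ are denoted $k_i$, $1\le k\le r$ (so $k_i$ is the $k$-th message of $\mathcal{I}_i$ and corresponds to the $k$-th column of $G^{\mathcal{I}_i}$; $\sigma_C(k)_j$ is the $\sigma_C(k)$-th message of $\mathcal{I}_j$; permuting the columns in $\mathcal{I}_i$ by $\sigma_C$ moves the column at $k_i$ to position $\sigma_C(k)_i$). Each block is of exactly one of the types $Type_A$, $Type_B$, $Type_C$, with the following properties. $Type_A$: for every block $\mathcal{I}_i\in Type_A$, every $k_i\in\mathcal{I}_i$ and every receiver $t$ demanding $k_i$: (a) $k_j\in S(t)$ for all $\mathcal{I}_j\in Type_A$ with $j\ne i$; (b) $\sigma_C(k)_j\in S(t)$ for all $\mathcal{I}_j\in Type_B$; (c) $k_j\in S(t)$ for all $\mathcal{I}_j\in Type_C$; (d) if $k$ is not a fixed point of $\sigma_C$, then $\sigma_C(k)_j\in S(t)$ for all $\mathcal{I}_j\in Type_C$. $Type_B$: the same properties as for $Type_A$ with the roles of $Type_A$ and $Type_B$ interchanged. $Type_C$: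 for every block $\mathcal{I}_i\in Type_C$, every $k_i\in\mathcal{I}_i$ and every receiver $t$ demanding $k_i$: (a) $k_j\in S(t)$ for all $\mathcal{I}_j\in Type_C$ with $j\neq i$; (b) if $k$ is not a fixed point of $\sigma_C$, then $\sigma_C(k)_j\in S(t)$ for all $\mathcal{I}_j\in Type_C$ (including $j=i$), and at least one of the following holds: (1) $k_j\in S(t)$ for every $\mathcal{I}_j\in Type_A$ and $\sigma_C(k)_j\in S(t)$ for every $\mathcal{I}_j\in Type_B$; or (2) $\sigma_C(k)_j\in S(t)$ for every $\mathcal{I}_j\in Type_A$ and $k_j\in S(t)$ for every $\mathcal{I}_j\in Type_B$; (c) if $k$ is a fixed point of $\sigma_C$, then $k_j\in S(t)$ for all $\mathcal{I}_j\in Type_A$ and $\sigma_C(k)_j\in S(t)$ for all $\mathcal{I}_j\in Type_B$. *)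

theory Defs
  imports
    "Jordan_Normal_Form.DL_Rank"
    "Jordan_Normal_Form.DL_Submatrix"
    "HOL-Combinatorics.Permutations"
    "HOL-Library.FuncSet"
begin

text \<open>
  All indices (messages, receivers, blocks, positions inside a block) are counted from 0.
  The finite field is the element type \<open>'a\<close> of the matrices.
\<close>

section \<open>Index coding problems and scalar linear index codes\<close>

datatype symbol = Sym0 | Sym1 | SymX

definition fitting_matrix :: "nat \<Rightarrow> nat \<Rightarrow> symbol mat \<Rightarrow> bool" where
  "fitting_matrix L K F \<longleftrightarrow>
     F \<in> carrier_mat L K \<and> K \<le> L \<and>
     (\<forall>t<L. \<exists>!k. k < K \<and> F $$ (t, k) = Sym1) \<and>
     (\<forall>k<K. \<exists>t<L. F $$ (t, k) = Sym1)"

definition demand :: "symbol mat \<Rightarrow> nat \<Rightarrow> nat" where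
  "demand F t = (THE k. k < dim_col F \<and> F $$ (t, k) = Sym1)"

definition side_info :: "symbol mat \<Rightarrow> nat \<Rightarrow> nat set" where
  "side_info F t = {k. k < dim_col F \<and> F $$ (t, k) = SymX}"

text \<open>
  A receiver decodes with an arbitrary function of the broadcast vector and of its side
  information. The latter is the message vector restricted to \<open>side_info F t\<close>: by
  \<^const>\<open>restrict\<close>, the decoder sees nothing outside that set.
\<close>

definition index_code :: "symbol mat \<Rightarrow> nat \<Rightarrow> 'a::field mat \<Rightarrow> bool" where
  "index_code F r G \<longleftrightarrow>
     G \<in> carrier_mat r (dim_col F) \<and>
     (\<forall>t < dim_row F. \<exists>dec :: 'a vec \<Rightarrow> (nat \<Rightarrow> 'a) \<Rightarrow> 'a.
        \<forall>x \<in> carrier_vec (dim_col F).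
          dec (G *\<^sub>v x) (restrict (\<lambda>k. x $ k) (side_info F t)) = x $ demand F t)"

definition optimal_index_code :: "symbol mat \<Rightarrow> nat \<Rightarrow> 'a::field mat \<Rightarrow> bool" where
  "optimal_index_code F r G \<longleftrightarrow>
     index_code F r G \<and> (\<forall>r' (G' :: 'a mat). index_code F r' G' \<longrightarrow> r \<le> r')"

definition optimal_length :: "'a::field itself \<Rightarrow> symbol mat \<Rightarrow> nat" where
  "optimal_length _ F = (LEAST r. \<exists>G :: 'a mat. index_code F r G)"

definition completions :: "symbol mat \<Rightarrow> 'a::field mat set" where
  "completions F =
     {M \<in> carrier_mat (dim_row F) (dim_col F).
        \<forall>t < dim_row F. \<forall>k < dim_col F.
          (F $$ (t, k) = Sym0 \<longrightarrow> M $$ (t, k) = 0) \<and>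
          (F $$ (t, k) = Sym1 \<longrightarrow> M $$ (t, k) = 1)}"

definition minrk :: "'a::field itself \<Rightarrow> symbol mat \<Rightarrow> nat" where
  "minrk _ F = (LEAST \<rho>. \<exists>M :: 'a mat. M \<in> completions F \<and> vec_space.rank (dim_row F) M = \<rho>)"


section \<open>Extensions\<close>

definition ic_extension :: "symbol mat \<Rightarrow> symbol mat \<Rightarrow> bool" where
  "ic_extension F F' \<longleftrightarrow>
     fitting_matrix (dim_row F) (dim_col F) F \<and>
     fitting_matrix (dim_row F') (dim_col F') F' \<and>
     (\<exists>I \<subseteq> {..<dim_row F'}. \<exists>J \<subseteq> {..<dim_col F'}. submatrix F' I J = F)"

definition two_order_extension :: "symbol mat \<Rightarrow> symbol mat \<Rightarrow> bool" where
  "two_order_extension F F' \<longleftrightarrow>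
     ic_extension F F' \<and> F' \<in> carrier_mat (2 * dim_row F) (2 * dim_col F)"

text \<open>
  Optimal code length and minrank are known to coincide; rank invariance is required here
  in both forms, so that the definition does not rely on that fact.
\<close>

definition rank_invariant :: "'a::field itself \<Rightarrow> symbol mat \<Rightarrow> symbol mat \<Rightarrow> bool" where
  "rank_invariant ty F F' \<longleftrightarrow>
     optimal_length ty F' = optimal_length ty F \<and> minrk ty F' = minrk ty F"


section \<open>Matrices\<close>

text \<open>Pre-multiplication by \<open>permutation_matrix r \<sigma>\<close> moves row \<open>k\<close> to row \<open>\<sigma> k\<close>.\<close>

definition permutation_matrix :: "nat \<Rightarrow> (nat \<Rightarrow> nat) \<Rightarrow> 'a::field mat" where
  "permutation_matrix r \<sigma> = mat r r (\<lambda>(a, b). if a = \<sigma> b then 1 else 0)"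

definition involutory_permutation_matrix :: "nat \<Rightarrow> (nat \<Rightarrow> nat) \<Rightarrow> 'a::field mat \<Rightarrow> bool" where
  "involutory_permutation_matrix r \<sigma> C \<longleftrightarrow>
     \<sigma> permutes {..<r} \<and> C = permutation_matrix r \<sigma> \<and> C * C = 1\<^sub>m r"

definition fixed_columns :: "nat \<Rightarrow> (nat \<Rightarrow> nat) \<Rightarrow> 'a::field mat" where
  "fixed_columns r \<sigma> = mat r r (\<lambda>(a, b). if \<sigma> b = b then 1\<^sub>m r $$ (a, b) else 0)"

definition append_cols :: "'a::zero mat \<Rightarrow> 'a mat \<Rightarrow> 'a mat" where
  "append_cols A B = four_block_mat A B (0\<^sub>m 0 (dim_col A)) (0\<^sub>m 0 (dim_col B))"

definition one_to_X :: "symbol \<Rightarrow> symbol" where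
  "one_to_X s = (if s = Sym1 then SymX else s)"


section \<open>Problems with blocks of types A, B, C\<close>

text \<open>
  \<open>msg i k\<close> is the \<open>k\<close>-th message \<open>k\<^sub>i\<close> of block \<open>i\<close>. Each block may list its
  messages in any order, not only the increasing one.
\<close>

definition message_blocks :: "nat \<Rightarrow> nat \<Rightarrow> (nat \<Rightarrow> nat \<Rightarrow> nat) \<Rightarrow> bool" where
  "message_blocks r T msg \<longleftrightarrow>
     bij_betw (\<lambda>(i, k). msg i k) ({..<T} \<times> {..<r}) {..<r * T}"

definition block_submatrix :: "nat \<Rightarrow> (nat \<Rightarrow> nat \<Rightarrow> nat) \<Rightarrow> nat \<Rightarrow> 'a mat \<Rightarrow> 'a mat" where
  "block_submatrix r msg i G = mat r r (\<lambda>(a, k). G $$ (a, msg i k))"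

datatype block_type = TypeA | TypeB | TypeC

definition blocks :: "nat \<Rightarrow> (nat \<Rightarrow> block_type) \<Rightarrow> block_type \<Rightarrow> nat set" where
  "blocks T kind X = {i. i < T \<and> kind i = X}"

text \<open>
  The requirements on types A and B differ only by exchanging the two types: \<open>P\<close> is the
  type under consideration and \<open>Q\<close> the other one.
\<close>

definition type_AB_property ::
  "block_type \<Rightarrow> block_type \<Rightarrow> nat \<Rightarrow> nat \<Rightarrow> (nat \<Rightarrow> nat) \<Rightarrow> (nat \<Rightarrow> nat \<Rightarrow> nat) \<Rightarrow>
   (nat \<Rightarrow> block_type) \<Rightarrow> symbol mat \<Rightarrow> bool" where
  "type_AB_property P Q r T \<sigma> msg kind F \<longleftrightarrow>
     (\<forall>i \<in> blocks T kind P. \<forall>k<r. \<forall>t < dim_row F. demand F t = msg i k \<longrightarrow>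
        (\<forall>j \<in> blocks T kind P. j \<noteq> i \<longrightarrow> msg j k \<in> side_info F t) \<and>
        (\<forall>j \<in> blocks T kind Q. msg j (\<sigma> k) \<in> side_info F t) \<and>
        (\<forall>j \<in> blocks T kind TypeC. msg j k \<in> side_info F t) \<and>
        (\<sigma> k \<noteq> k \<longrightarrow> (\<forall>j \<in> blocks T kind TypeC. msg j (\<sigma> k) \<in> side_info F t)))"

definition type_C_property ::
  "nat \<Rightarrow> nat \<Rightarrow> (nat \<Rightarrow> nat) \<Rightarrow> (nat \<Rightarrow> nat \<Rightarrow> nat) \<Rightarrow>
   (nat \<Rightarrow> block_type) \<Rightarrow> symbol mat \<Rightarrow> bool" where
  "type_C_property r T \<sigma> msg kind F \<longleftrightarrow>
     (\<forall>i \<in> blocks T kind TypeC. \<forall>k<r. \<forall>t < dim_row F. demand F t = msg i k \<longrightarrow>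
        (\<forall>j \<in> blocks T kind TypeC. j \<noteq> i \<longrightarrow> msg j k \<in> side_info F t) \<and>
        (\<sigma> k \<noteq> k \<longrightarrow>
           (\<forall>j \<in> blocks T kind TypeC. msg j (\<sigma> k) \<in> side_info F t) \<and>
           ((\<forall>j \<in> blocks T kind TypeA. msg j k \<in> side_info F t) \<and>
            (\<forall>j \<in> blocks T kind TypeB. msg j (\<sigma> k) \<in> side_info F t) \<or>
            (\<forall>j \<in> blocks T kind TypeA. msg j (\<sigma> k) \<in> side_info F t) \<and>
            (\<forall>j \<in> blocks T kind TypeB. msg j k \<in> side_info F t))) \<and>
        (\<sigma> k = k \<longrightarrow>
           (\<forall>j \<in> blocks T kind TypeA. msg j k \<in> side_info F t) \<and>
           (\<forall>j \<in> blocks T kind TypeB. msg j (\<sigma> k) \<in> side_info F t)))"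

definition ABC_problem ::
  "nat \<Rightarrow> nat \<Rightarrow> nat \<Rightarrow> (nat \<Rightarrow> nat) \<Rightarrow> (nat \<Rightarrow> nat \<Rightarrow> nat) \<Rightarrow>
   (nat \<Rightarrow> block_type) \<Rightarrow> symbol mat \<Rightarrow> bool" where
  "ABC_problem L r T \<sigma> msg kind F \<longleftrightarrow>
     fitting_matrix L (r * T) F \<and> message_blocks r T msg \<and>
     type_AB_property TypeA TypeB r T \<sigma> msg kind F \<and>
     type_AB_property TypeB TypeA r T \<sigma> msg kind F \<and>
     type_C_property r T \<sigma> msg kind F"

text \<open>\<open>P\<close> is \<open>F\<close> with the columns of every block permuted by \<open>\<sigma>\<close>.\<close>

definition block_permuted ::
  "nat \<Rightarrow> nat \<Rightarrow> (nat \<Rightarrow> nat) \<Rightarrow> (nat \<Rightarrow> nat \<Rightarrow> nat) \<Rightarrow> symbol mat \<Rightarrow> symbol mat \<Rightarrow> bool" where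
  "block_permuted r T \<sigma> msg F P \<longleftrightarrow>
     P \<in> carrier_mat (dim_row F) (dim_col F) \<and>
     (\<forall>i<T. \<forall>k<r. col P (msg i (\<sigma> k)) = col F (msg i k))"

end

theory Submission
  imports Defs
begin

text \<open>
  The type properties imply that for every receiver some row \<open>a\<close> of \<open>G\<close> has a \<open>1\<close> at the
  demanded message and vanishes at every position where \<open>F\<close> has a \<open>0\<close>. Collecting these row
  selections in a matrix \<open>D\<close>, the product \<open>D * G\<close> is a completion of \<open>F\<close>. Since each
  block of \<open>G\<close> commutes with \<open>C\<close>, the matrix \<open>C * G\<close> is \<open>G\<close> with the columns of every block
  permuted by \<open>\<sigma>\<close>; hence \<open>D\<close> stacked on \<open>D * C\<close>, multiplied by \<open>(G  CG)\<close>, completes the extended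
  matrix. A completion that factors through \<open>r\<close> rows of a code yields decoders, and its rank is at
  most \<open>r\<close>. Conversely, a rank factorization turns any completion into a code of length equal to its
  rank, so for an optimal code of length \<open>r\<close> with such a completion both the optimal length and the
  minrank are \<open>r\<close>. Setting the second half of the messages to zero turns a code for the extension
  into one for \<open>F\<close>, which gives optimality of \<open>(G  CG)\<close>.
\<close>

section \<open>Rank bounds and rank factorization\<close>

context vec_space
begin

text \<open>The columns of \<open>A * B\<close> lie in the span of the at most \<open>m\<close>
  columns of \<open>A\<close>, so Steinitz exchange bounds the size of any independent set among
  them.\<close>

lemma rank_mult_le:
  assumes A: "A \<in> carrier_mat n m" and B: "B \<in> carrier_mat m k"
  shows "rank (A * B) \<le> m"
proof -
  have AB: "A * B \<in> carrier_mat n k"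
    using A B by simp
  obtain S where S: "maximal S (\<lambda>T. T \<subseteq> set (cols (A * B)) \<and> lin_indpt T)" and fin: "finite S"
    using maximal_exists_superset[of "set (cols (A * B))" "\<lambda>T. T \<subseteq> set (cols (A * B)) \<and> lin_indpt T" "{}"]
    by (auto simp: lin_dep_def)
  have sub: "S \<subseteq> set (cols (A * B))" and li: "lin_indpt S"
    using S by (auto simp: maximal_def)
  have colsA: "set (cols A) \<subseteq> carrier_vec n"
    using A cols_dim by blast
  have "set (cols (A * B)) \<subseteq> span (set (cols A))"
  proof
    fix v assume "v \<in> set (cols (A * B))"
    then obtain j where j: "j < k" "v = col (A * B) j"
      using AB by (auto simp: cols_def)
    then have v: "v = A *\<^sub>v col B j"
      using A B by auto
    have "col B j \<in> carrier_vec (length (cols A))"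
      using A B j by auto
    then have "vec (length (cols A)) (\<lambda>i. col B j $ i) = col B j"
      by (metis carrier_vecD eq_vecI dim_vec index_vec)
    then have "v = lincomb_list (\<lambda>i. col B j $ i) (cols A)"
      using v A colsA by (subst lincomb_list_as_mat_mult) auto
    then have "v \<in> span_list (cols A)"
      by (auto simp: in_span_listI)
    then show "v \<in> span (set (cols A))"
      using span_list_as_span[OF colsA] by simp
  qed
  then have "S \<subseteq> span (set (cols A))"
    using sub by blast
  \<comment> \<open>Exchange is stated with an integer difference bounding \<open>card R\<close>;
    since \<open>card R\<close> is nonnegative, so is the difference.\<close>
  then obtain R :: "'a vec set" where "int (card R) \<le> int (card (set (cols A))) - int (card S)"
    using replacement[OF fin _ _ li, of "set (cols A)"] colsA by auto
  then have "card S \<le> card (set (cols A))"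
    by linarith
  also have "\<dots> \<le> m"
    using A card_length[of "cols A"] by simp
  finally show ?thesis
    using rank_card_indpt[OF AB S] by simp
qed

text \<open>A maximal independent set of columns supplies \<open>D\<close>. By maximality it spans
  every column of \<open>A\<close>, and the coefficient vectors are the columns of
  \<open>E\<close>.\<close>

lemma rank_factorization:
  assumes A: "A \<in> carrier_mat n m"
  obtains D E where "D \<in> carrier_mat n (rank A)" "E \<in> carrier_mat (rank A) m" "A = D * E"
proof -
  obtain S where S: "maximal S (\<lambda>T. T \<subseteq> set (cols A) \<and> lin_indpt T)" and fin: "finite S"
    using maximal_exists_superset[of "set (cols A)" "\<lambda>T. T \<subseteq> set (cols A) \<and> lin_indpt T" "{}"]
    by (auto simp: lin_dep_def)
  have sub: "S \<subseteq> set (cols A)" and li: "lin_indpt S"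
    using S by (auto simp: maximal_def)
  have colsA: "set (cols A) \<subseteq> carrier_vec n"
    using A cols_dim by blast
  have rk: "rank A = card S"
    using rank_card_indpt[OF A S] .
  have Sc: "S \<subseteq> carrier_vec n"
    using sub colsA by blast
  have spn: "v \<in> span S" if v: "v \<in> set (cols A)" for v
  proof (rule ccontr)
    assume nin: "v \<notin> span S"
    have "v \<in> carrier_vec n"
      using v colsA by blast
    then have "lin_indpt (insert v S)"
      using lin_dep_iff_in_span[of S v] nin li Sc span_mem[OF Sc] by auto
    then have "insert v S = S"
      using S v sub unfolding maximal_def by (metis insert_subset subset_insertI)
    then show False
      using nin span_mem[OF Sc] by auto
  qed
  \<comment> \<open>Distinctness makes the number of columns of \<open>D\<close> exactly
    \<open>card S\<close>, the rank.\<close>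
  obtain xs where xs: "set xs = S" "distinct xs"
    using fin finite_distinct_list by blast
  have len: "length xs = rank A"
    using xs rk distinct_card by fastforce
  define D where "D = mat_of_cols n xs"
  have D: "D \<in> carrier_mat n (rank A)"
    unfolding D_def len[symmetric] by (rule mat_of_cols_carrier)
  have colsD: "cols D = xs"
    using xs Sc by (simp add: D_def cols_mat_of_cols)
  have "\<exists>w \<in> carrier_vec (rank A). col A j = D *\<^sub>v w" if "j < m" for j
  proof -
    have "col A j \<in> span S"
      using that A by (intro spn) (auto simp: cols_def)
    then obtain a where "col A j = lincomb a S"
      using finite_span[OF fin] Sc by auto
    also have "\<dots> = D *\<^sub>v vec (rank A) (\<lambda>i. a (col D i))"
      using mat_mult_eq_lincomb[OF D, of a] xs by (simp add: colsD)
    finally show ?thesis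
      using vec_carrier by blast
  qed
  then obtain w where w: "\<And>j. j < m \<Longrightarrow> w j \<in> carrier_vec (rank A) \<and> col A j = D *\<^sub>v w j"
    by metis
  define E where "E = mat_of_cols (rank A) (map w [0..<m])"
  have E: "E \<in> carrier_mat (rank A) m"
    using mat_of_cols_carrier(1)[of "rank A" "map w [0..<m]"] by (simp add: E_def)
  have "col A j = col (D * E) j" if "j < m" for j
    using that w[OF that] D E by (simp add: E_def mult_mat_vec_def)
  then have "A = D * E"
    using A D E by (intro mat_col_eqI) auto
  with D E show thesis
    using that by blast
qed

end

section \<open>Completions of a fitting matrix and index codes\<close>

lemma fitting_matrix_demand:
  assumes "fitting_matrix L K F" "t < L"
  shows "demand F t < K" "F $$ (t, demand F t) = Sym1"
    "k < K \<Longrightarrow> F $$ (t, k) = Sym1 \<Longrightarrow> k = demand F t"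
proof -
  have ex: "\<exists>!k. k < K \<and> F $$ (t, k) = Sym1" and dim: "dim_col F = K"
    using assms by (auto simp: fitting_matrix_def)
  show "demand F t < K" "F $$ (t, demand F t) = Sym1"
    using theI'[OF ex] by (auto simp: demand_def dim)
  then show "k < K \<Longrightarrow> F $$ (t, k) = Sym1 \<Longrightarrow> k = demand F t"
    using ex by blast
qed

text \<open>Row \<open>t\<close> of \<open>D\<close> turns the broadcast into entry \<open>t\<close>
  of \<open>D * G\<close> applied to \<open>x\<close>, with coefficient 1 at the demand and 0 at
  every \<open>Sym0\<close>. Subtracting the side-information terms leaves the demanded
  symbol.\<close>

lemma index_code_of_completion:
  fixes D G :: "'a::field mat"
  assumes F: "fitting_matrix L K F" and D: "D \<in> carrier_mat L r" and G: "G \<in> carrier_mat r K"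
    and M: "D * G \<in> completions F"
  shows "index_code F r G"
proof -
  have dim: "dim_row F = L" "dim_col F = K"
    using F by (auto simp: fitting_matrix_def)
  have "\<exists>dec :: 'a vec \<Rightarrow> (nat \<Rightarrow> 'a) \<Rightarrow> 'a. \<forall>x \<in> carrier_vec K.
          dec (G *\<^sub>v x) (restrict (\<lambda>k. x $ k) (side_info F t)) = x $ demand F t"
    if t: "t < L" for t
  proof (rule exI[of _ "\<lambda>y s. row D t \<bullet> y - (\<Sum>k\<in>side_info F t. (D * G) $$ (t, k) * s k)"], rule ballI)
    fix x :: "'a vec"
    assume x: "x \<in> carrier_vec K"
    let ?S = "side_info F t" and ?d = "demand F t" and ?M = "D * G"
    note d = fitting_matrix_demand[OF F t]
    have S: "?S \<subseteq> {..<K} - {?d}"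
      using d(1,2) by (auto simp: side_info_def dim)
    have "row D t \<bullet> (G *\<^sub>v x) = (D *\<^sub>v (G *\<^sub>v x)) $ t"
      using D t by simp
    also have "D *\<^sub>v (G *\<^sub>v x) = ?M *\<^sub>v x"
      using D G x by simp
    also have "(?M *\<^sub>v x) $ t = (\<Sum>k<K. ?M $$ (t, k) * x $ k)"
      using D G x t by (auto simp del: assoc_mult_mat_vec simp: scalar_prod_def atLeast0LessThan intro!: sum.cong)
    also have "\<dots> = ?M $$ (t, ?d) * x $ ?d + (\<Sum>k\<in>{..<K} - {?d}. ?M $$ (t, k) * x $ k)"
      using d(1) by (subst sum.remove[of _ ?d]) auto
    also have "?M $$ (t, ?d) = 1"
      using M d(1,2) t by (simp add: completions_def dim)
    also have "(\<Sum>k\<in>{..<K} - {?d}. ?M $$ (t, k) * x $ k) = (\<Sum>k\<in>?S. ?M $$ (t, k) * x $ k)"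
    proof (rule sum.mono_neutral_right[OF _ S], simp, intro ballI)
      \<comment> \<open>The row has no second \<open>Sym1\<close>, so every position outside the
        demand and the side information carries \<open>Sym0\<close>.\<close>
      fix k assume k: "k \<in> {..<K} - {?d} - ?S"
      then have "F $$ (t, k) \<noteq> Sym1" "F $$ (t, k) \<noteq> SymX"
        using d(3)[of k] by (auto simp: side_info_def dim)
      then have "F $$ (t, k) = Sym0"
        by (metis symbol.exhaust)
      then show "?M $$ (t, k) * x $ k = 0"
        using M t k by (simp add: completions_def dim)
    qed
    finally show "row D t \<bullet> (G *\<^sub>v x) - (\<Sum>k\<in>?S. ?M $$ (t, k) * restrict (\<lambda>k. x $ k) ?S k) = x $ ?d"
      by simp
  qed
  then show ?thesis
    using G by (simp add: index_code_def dim)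
qed

text \<open>A completion factors through as many rows as its rank and so yields a code of that
  length; optimality then makes \<open>r\<close> a lower bound for all ranks. The factor
  \<open>D\<close> of the given completion shows that the bound is attained.\<close>

lemma optimal_factored_completion:
  fixes D G :: "'a::field mat"
  assumes F: "fitting_matrix L K F" and opt: "optimal_index_code F r G"
    and D: "D \<in> carrier_mat L r" and M: "D * G \<in> completions F"
  shows "optimal_length TYPE('a) F = r" "minrk TYPE('a) F = r"
proof -
  have dim: "dim_row F = L" "dim_col F = K"
    using F by (auto simp: fitting_matrix_def)
  have G: "G \<in> carrier_mat r K" and code: "index_code F r G"
    using opt by (auto simp: optimal_index_code_def index_code_def dim)
  have min: "r \<le> r'" if "index_code F r' (G' :: 'a mat)" for r' G'
    using opt that by (auto simp: optimal_index_code_def)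
  show "optimal_length TYPE('a) F = r"
    unfolding optimal_length_def using code min by (intro Least_equality) auto
  have lower: "r \<le> vec_space.rank L (N :: 'a mat)" if N: "N \<in> completions F" for N
  proof -
    have "N \<in> carrier_mat L K"
      using N by (simp add: completions_def dim)
    then obtain D' E where "D' \<in> carrier_mat L (vec_space.rank L N)"
        "E \<in> carrier_mat (vec_space.rank L N) K" "N = D' * E"
      by (rule vec_space.rank_factorization)
    then show ?thesis
      using index_code_of_completion[OF F] N min by blast
  qed
  have "vec_space.rank L (D * G) = r"
    using vec_space.rank_mult_le[OF D G] lower[OF M] by simp
  then show "minrk TYPE('a) F = r"
    unfolding minrk_def dim using M lower by (intro Least_equality) auto
qed

section \<open>The extended fitting matrix\<close>

lemma fitting_matrix_four_block:
  assumes F: "fitting_matrix L K F" and B: "B \<in> carrier_mat L K"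
    and no1: "\<And>t k. t < L \<Longrightarrow> k < K \<Longrightarrow> B $$ (t, k) \<noteq> Sym1"
  shows "fitting_matrix (2 * L) (2 * K) (four_block_mat F B B F)"
    (is "fitting_matrix _ _ ?F")
proof -
  have c: "F \<in> carrier_mat L K" "K \<le> L"
    using F by (auto simp: fitting_matrix_def)
  have ix: "?F $$ (t, k) =
      (if t < L then if k < K then F $$ (t, k) else B $$ (t, k - K)
       else if k < K then B $$ (t - L, k) else F $$ (t - L, k - K))"
    if "t < 2 * L" "k < 2 * K" for t k
    using that c B by (simp add: index_mat_four_block)
  have "\<exists>!k. k < 2 * K \<and> ?F $$ (t, k) = Sym1" if t: "t < 2 * L" for t
  proof (cases "t < L")
    case True
    note d = fitting_matrix_demand[OF F True]
    show ?thesis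
    proof (rule ex1I[of _ "demand F t"])
      show "demand F t < 2 * K \<and> ?F $$ (t, demand F t) = Sym1"
        using d(1,2) True by (simp add: ix)
      show "k = demand F t" if "k < 2 * K \<and> ?F $$ (t, k) = Sym1" for k
      proof (cases "k < K")
        case True
        then show ?thesis
          using that d(3)[of k] \<open>t < L\<close> by (simp add: ix)
      next
        case False
        then have "k - K < K"
          using that by linarith
        then show ?thesis
          using that no1[of t "k - K"] False \<open>t < L\<close> by (simp add: ix)
      qed
    qed
  next
    case False
    then have tL: "t - L < L"
      using t by simp
    note d = fitting_matrix_demand[OF F tL]
    \<comment> \<open>A lower row repeats row \<open>t - L\<close> of \<open>F\<close> in the right
      half, which shifts its demand by \<open>K\<close>.\<close>
    show ?thesis
    proof (rule ex1I[of _ "demand F (t - L) + K"])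
      show "demand F (t - L) + K < 2 * K \<and> ?F $$ (t, demand F (t - L) + K) = Sym1"
        using d(1,2) False t by (simp add: ix)
      show "k = demand F (t - L) + K" if "k < 2 * K \<and> ?F $$ (t, k) = Sym1" for k
      proof (cases "k < K")
        case True
        then show ?thesis
          using that no1[OF tL, of k] \<open>\<not> t < L\<close> t by (simp add: ix)
      next
        case False
        then have "k - K < K"
          using that by linarith
        then show ?thesis
          using that d(3)[of "k - K"] False \<open>\<not> t < L\<close> t by (simp add: ix)
      qed
    qed
  qed
  moreover have "\<exists>t < 2 * L. ?F $$ (t, k) = Sym1" if k: "k < 2 * K" for k
  proof (cases "k < K")
    case True
    then obtain t where "t < L" "F $$ (t, k) = Sym1"
      using F by (auto simp: fitting_matrix_def)
    then show ?thesis
      using True by (intro exI[of _ t]) (auto simp: ix)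
  next
    case False
    then have "k - K < K"
      using k by simp
    then obtain t where "t < L" "F $$ (t, k - K) = Sym1"
      using F by (auto simp: fitting_matrix_def)
    then show ?thesis
      using False k by (intro exI[of _ "t + L"]) (auto simp: ix)
  qed
  ultimately show ?thesis
    using c B by (auto simp: fitting_matrix_def)
qed

lemma submatrix_four_block_upper_left:
  assumes "A \<in> carrier_mat n m"
  shows "submatrix (four_block_mat A B C D) {..<n} {..<m} = A"
proof -
  \<comment> \<open>\<open>submatrix\<close> addresses entries through \<open>pick\<close>, which is
    the identity on an initial segment.\<close>
  have pick: "pick {..<l} i = i" if "i < l" for i l :: nat
  proof -
    have "{a \<in> {..<l}. a < i} = {..<i}"
      using that by auto
    then show ?thesis
      using pick_card_in_set[of i "{..<l}"] that by simp
  qed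
  have "{i. i < n + d \<and> i \<in> {..<n}} = {..<n}" for n d :: nat
    by auto
  then show ?thesis
    using assms by (intro eq_matI) (auto simp: submatrix_def pick index_mat_four_block)
qed

text \<open>The code for \<open>F\<close> consists of the first \<open>K\<close> columns of
  \<open>G\<close>: broadcasting with it is broadcasting with \<open>G\<close> when the second half
  of the messages is zero. This carries lower bounds on the length from \<open>F\<close> to the
  extension.\<close>

lemma index_code_four_block_left:
  fixes G :: "'a::field mat"
  assumes F: "fitting_matrix L K F" and F': "fitting_matrix (2 * L) (2 * K) (four_block_mat F B B F)"
    and code: "index_code (four_block_mat F B B F) r G"
  shows "\<exists>G' :: 'a mat. index_code F r G'"
proof -
  let ?F = "four_block_mat F B B F"
  have c: "F \<in> carrier_mat L K"
    using F by (auto simp: fitting_matrix_def)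
  have G: "G \<in> carrier_mat r (2 * K)"
    using code c by (simp add: index_code_def mult_2)
  define G' where "G' = mat r K (\<lambda>(a, k). G $$ (a, k))"
  have "\<exists>dec' :: 'a vec \<Rightarrow> (nat \<Rightarrow> 'a) \<Rightarrow> 'a. \<forall>x \<in> carrier_vec K.
          dec' (G' *\<^sub>v x) (restrict (\<lambda>k. x $ k) (side_info F t)) = x $ demand F t"
    if t: "t < L" for t
  proof -
    have "t < dim_row ?F" and dimF: "dim_col ?F = 2 * K"
      using t c by auto
    with code obtain dec :: "'a vec \<Rightarrow> (nat \<Rightarrow> 'a) \<Rightarrow> 'a" where
      dec: "x \<in> carrier_vec (2 * K) \<Longrightarrow>
        dec (G *\<^sub>v x) (restrict (\<lambda>k. x $ k) (side_info ?F t)) = x $ demand ?F t" for x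
      unfolding index_code_def dimF by blast
    \<comment> \<open>The given decoder may also ask for side information from the second half;
      those symbols are known to vanish, so 0 is supplied.\<close>
    let ?dec = "\<lambda>y s. dec y (\<lambda>k\<in>side_info ?F t. if k < K then s k else 0)"
    have dK: "demand F t < K"
      by (rule fitting_matrix_demand(1)[OF F t])
    then have "?F $$ (t, demand F t) = Sym1"
      using fitting_matrix_demand(2)[OF F t] t c by (simp add: index_mat_four_block)
    then have d: "demand F t = demand ?F t"
      using t dK by (intro fitting_matrix_demand(3)[OF F']) simp_all
    have "?dec (G' *\<^sub>v x) (restrict (\<lambda>k. x $ k) (side_info F t)) = x $ demand F t"
      if x: "x \<in> carrier_vec K" for x
    proof -
      let ?x = "x @\<^sub>v 0\<^sub>v K"
      have x2: "?x \<in> carrier_vec (2 * K)"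
        using x by (simp add: mult_2)
      have "G *\<^sub>v ?x = G' *\<^sub>v x"
      proof (rule eq_vecI)
        fix a assume "a < dim_vec (G' *\<^sub>v x)"
        then have a: "a < r"
          by (simp add: G'_def)
        have "(G *\<^sub>v ?x) $ a = (\<Sum>k<2 * K. G $$ (a, k) * ?x $ k)"
          using G a x x2 by (auto simp: scalar_prod_def atLeast0LessThan intro!: sum.cong)
        also have "\<dots> = (\<Sum>k<K. G $$ (a, k) * ?x $ k)"
          using x by (intro sum.mono_neutral_right) auto
        also have "\<dots> = (G' *\<^sub>v x) $ a"
          using a x by (auto simp: G'_def scalar_prod_def atLeast0LessThan intro!: sum.cong)
        finally show "(G *\<^sub>v ?x) $ a = (G' *\<^sub>v x) $ a" .
      qed (use G in \<open>simp add: G'_def\<close>)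
      \<comment> \<open>Row \<open>t\<close> lies in the upper half, so below \<open>K\<close> its
        side information is the same for \<open>?F\<close> and \<open>F\<close>, and the inner
        restriction loses nothing.\<close>
      moreover have "(\<lambda>k\<in>side_info ?F t. if k < K then restrict (\<lambda>k. x $ k) (side_info F t) k else 0)
          = restrict (\<lambda>k. ?x $ k) (side_info ?F t)"
        using x c t by (auto simp: side_info_def restrict_def index_mat_four_block fun_eq_iff)
      ultimately show ?thesis
        using dec[OF x2] dK x by (simp add: d[symmetric])
    qed
    then show ?thesis
      by (intro exI[of _ ?dec] ballI)
  qed
  then have "index_code F r G'"
    using c by (auto simp: index_code_def G'_def)
  then show ?thesis ..
qed

section \<open>Involutory permutation matrices and the type properties\<close>

lemma permutation_matrix_mult_index:
  fixes G :: "'a::field mat"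
  assumes \<sigma>: "\<sigma> permutes {..<r}" and G: "G \<in> carrier_mat r K" and "b < r" "k < K"
  shows "(permutation_matrix r \<sigma> * G) $$ (\<sigma> b, k) = G $$ (b, k)"
proof -
  have "\<sigma> b < r"
    using permutes_in_image[OF \<sigma>, of b] \<open>b < r\<close> by simp
  then have "(permutation_matrix r \<sigma> * G) $$ (\<sigma> b, k)
      = (\<Sum>c<r. (if \<sigma> b = \<sigma> c then 1 else 0) * G $$ (c, k))"
    using assms by (auto simp: permutation_matrix_def scalar_prod_def atLeast0LessThan intro!: sum.cong)
  also have "\<dots> = (\<Sum>c<r. if b = c then G $$ (c, k) else 0)"
    using permutes_inj[OF \<sigma>] by (intro sum.cong) (auto simp: inj_def)
  also have "\<dots> = G $$ (b, k)"
    using \<open>b < r\<close> by simp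
  finally show ?thesis .
qed

text \<open>The entry of \<open>C * C\<close> at row \<open>\<sigma> (\<sigma> k)\<close> and column
  \<open>k\<close> is 1, whereas the identity matrix is nonzero only on its diagonal.\<close>

lemma involutory_permutation_matrix_involution:
  assumes C: "involutory_permutation_matrix r \<sigma> (C :: 'a::field mat)" and "k < r"
  shows "\<sigma> (\<sigma> k) = k"
proof -
  have \<sigma>: "\<sigma> permutes {..<r}" and Ceq: "C = permutation_matrix r \<sigma>" and CC: "C * C = 1\<^sub>m r"
    using C by (auto simp: involutory_permutation_matrix_def)
  have lt: "\<sigma> k < r" "\<sigma> (\<sigma> k) < r"
    using permutes_in_image[OF \<sigma>] \<open>k < r\<close> by auto
  have "(C * C) $$ (\<sigma> (\<sigma> k), k) = C $$ (\<sigma> k, k)"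
    using permutation_matrix_mult_index[OF \<sigma>, of C r "\<sigma> k" k] lt \<open>k < r\<close>
    by (simp add: Ceq permutation_matrix_def)
  then show ?thesis
    using lt \<open>k < r\<close> by (auto simp: CC) (auto simp: Ceq permutation_matrix_def split: if_splits)
qed

text \<open>Row \<open>a\<close> of \<open>G\<close> is supported at position \<open>a\<close> in
  blocks of type A, at \<open>\<sigma> a\<close> in type B, and at both in type C. The conclusions
  place this support inside the demand and side information of \<open>t\<close>, and the demand
  inside the support.\<close>

lemma ABC_decoding_row:
  assumes ABC: "ABC_problem L r T \<sigma> msg kind F"
    and \<sigma>: "\<sigma> permutes {..<r}" "\<And>k. k < r \<Longrightarrow> \<sigma> (\<sigma> k) = k"
    and t: "t < L"
  obtains a where "a < r"
    "\<And>j. j \<in> blocks T kind TypeA \<Longrightarrow> msg j a \<in> insert (demand F t) (side_info F t)"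
    "\<And>j. j \<in> blocks T kind TypeB \<Longrightarrow> msg j (\<sigma> a) \<in> insert (demand F t) (side_info F t)"
    "\<And>j. j \<in> blocks T kind TypeC \<Longrightarrow> {msg j a, msg j (\<sigma> a)} \<subseteq> insert (demand F t) (side_info F t)"
    "\<exists>i k. demand F t = msg i k \<and> i < T \<and> k < r \<and>
       (case kind i of TypeA \<Rightarrow> k = a | TypeB \<Rightarrow> k = \<sigma> a | TypeC \<Rightarrow> k = a \<or> k = \<sigma> a)"
proof -
  have F: "fitting_matrix L (r * T) F" and msg: "message_blocks r T msg"
    and A: "type_AB_property TypeA TypeB r T \<sigma> msg kind F"
    and B: "type_AB_property TypeB TypeA r T \<sigma> msg kind F"
    and C: "type_C_property r T \<sigma> msg kind F"
    using ABC by (auto simp: ABC_problem_def)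
  have tF: "t < dim_row F"
    using F t by (auto simp: fitting_matrix_def)
  have "demand F t \<in> (\<lambda>(i, k). msg i k) ` ({..<T} \<times> {..<r})"
    using msg fitting_matrix_demand(1)[OF F t] by (simp add: message_blocks_def bij_betw_def)
  then obtain i k where d: "demand F t = msg i k" and i: "i < T" and k: "k < r"
    by auto
  note s = \<sigma>(2)[OF k]
  have sk: "\<sigma> k < r"
    using permutes_in_image[OF \<sigma>(1), of k] k by simp
  let ?S = "side_info F t"
  show thesis
  proof (cases "kind i")
    case TypeA
    then have iA: "i \<in> blocks T kind TypeA"
      using i by (simp add: blocks_def)
    note * = A[unfolded type_AB_property_def, rule_format, OF iA k tF d]
    show thesis
    proof (rule that[OF k])
      show "msg j k \<in> insert (demand F t) ?S" if "j \<in> blocks T kind TypeA" for j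
        using * that d by (cases "j = i") auto
      show "msg j (\<sigma> k) \<in> insert (demand F t) ?S" if "j \<in> blocks T kind TypeB" for j
        using * that by blast
      show "{msg j k, msg j (\<sigma> k)} \<subseteq> insert (demand F t) ?S" if "j \<in> blocks T kind TypeC" for j
        using * that by (cases "\<sigma> k = k") auto
    qed (use d i k TypeA in \<open>intro exI[of _ i] exI[of _ k], simp\<close>)
  next
    case TypeB
    then have iB: "i \<in> blocks T kind TypeB"
      using i by (simp add: blocks_def)
    note * = B[unfolded type_AB_property_def, rule_format, OF iB k tF d]
    \<comment> \<open>With \<open>a = \<sigma> k\<close>, the support in blocks of type B is at
      \<open>\<sigma> a = k\<close>, the position of the demand.\<close>
    show thesis
    proof (rule that[OF sk])
      show "msg j (\<sigma> k) \<in> insert (demand F t) ?S" if "j \<in> blocks T kind TypeA" for j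
        using * that by blast
      show "msg j (\<sigma> (\<sigma> k)) \<in> insert (demand F t) ?S" if "j \<in> blocks T kind TypeB" for j
        using * that d by (cases "j = i") (auto simp: s)
      show "{msg j (\<sigma> k), msg j (\<sigma> (\<sigma> k))} \<subseteq> insert (demand F t) ?S"
        if "j \<in> blocks T kind TypeC" for j
        using * that by (cases "\<sigma> k = k") (auto simp: s)
    qed (use d i k s TypeB in \<open>intro exI[of _ i] exI[of _ k], simp\<close>)
  next
    case TypeC
    then have iC: "i \<in> blocks T kind TypeC"
      using i by (simp add: blocks_def)
    note * = C[unfolded type_C_property_def, rule_format, OF iC k tF d]
    \<comment> \<open>Being symmetric in \<open>k\<close> and \<open>\<sigma> k\<close>, this fact
      serves both choices of \<open>a\<close> below.\<close>
    have C: "{msg j k, msg j (\<sigma> k)} \<subseteq> insert (demand F t) ?S" if "j \<in> blocks T kind TypeC" for j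
      using * that d by (cases "j = i"; cases "\<sigma> k = k") auto
    \<comment> \<open>The two alternatives for type C lead to \<open>a = k\<close> and
      \<open>a = \<sigma> k\<close>. At a fixed point the first one always holds.\<close>
    show thesis
    proof (cases "(\<forall>j \<in> blocks T kind TypeA. msg j k \<in> ?S) \<and>
        (\<forall>j \<in> blocks T kind TypeB. msg j (\<sigma> k) \<in> ?S)")
      case True
      show thesis
        by (rule that[OF k], (use True C in blast)+)
          (use d i k TypeC in \<open>intro exI[of _ i] exI[of _ k], simp\<close>)
    next
      case False
      then have *: "(\<forall>j \<in> blocks T kind TypeA. msg j (\<sigma> k) \<in> ?S) \<and>
          (\<forall>j \<in> blocks T kind TypeB. msg j k \<in> ?S)"
        using * by blast
      show thesis
        by (rule that[OF sk], (use * C s in fastforce)+)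
          (use d i k TypeC s in \<open>intro exI[of _ i] exI[of _ k], simp\<close>)
    qed
  qed
qed

section \<open>The code for the extension, its optimality and rank invariance\<close>

theorem corollary1:
  fixes r T L :: nat
    and \<sigma> :: "nat \<Rightarrow> nat"
    and msg :: "nat \<Rightarrow> nat \<Rightarrow> nat"
    and kind :: "nat \<Rightarrow> block_type"
    and F P B Fext :: "symbol mat"
    and C C1 G :: "'a::{field, finite} mat"
  assumes "0 < r" and "0 < T"
    and "involutory_permutation_matrix r \<sigma> C"
    and "ABC_problem L r T \<sigma> msg kind F"
    and "C1 = fixed_columns r \<sigma>"
    and "G \<in> carrier_mat r (r * T)"
    and "\<And>i. i < T \<Longrightarrow> block_submatrix r msg i G =
           (case kind i of TypeA \<Rightarrow> 1\<^sub>m r | TypeB \<Rightarrow> C | TypeC \<Rightarrow> 1\<^sub>m r + C - C1)"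
    and "block_permuted r T \<sigma> msg F P"
    and "B = map_mat one_to_X P"
    and "Fext = four_block_mat F B B F"
  shows "index_code Fext r (append_cols G (C * G)) \<and>
    (optimal_index_code F r G \<longrightarrow>
       optimal_index_code Fext r (append_cols G (C * G)) \<and>
       two_order_extension F Fext \<and>
       rank_invariant TYPE('a) F Fext)"
proof -
  have \<sigma>: "\<sigma> permutes {..<r}" and Ceq: "C = permutation_matrix r \<sigma>" and CC: "C * C = 1\<^sub>m r"
    using assms(3) by (auto simp: involutory_permutation_matrix_def)
  note \<sigma>\<sigma> = involutory_permutation_matrix_involution[OF assms(3)]
  have \<sigma>r: "\<sigma> k < r" if "k < r" for k
    using permutes_in_image[OF \<sigma>] that by auto
  have \<sigma>inj: "\<sigma> x = \<sigma> y \<longleftrightarrow> x = y" for x y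
    using permutes_inj[OF \<sigma>] by (auto simp: inj_def)
  define K where "K = r * T"
  have Cc: "C \<in> carrier_mat r r"
    by (simp add: Ceq permutation_matrix_def)
  have Gc: "G \<in> carrier_mat r K"
    using assms(6) by (simp add: K_def)
  have F: "fitting_matrix L K F" and msg: "message_blocks r T msg"
    using assms(4) by (auto simp: ABC_problem_def K_def)
  have Fc: "F \<in> carrier_mat L K"
    using F by (simp add: fitting_matrix_def)
  have msgK: "msg i k < K" if "i < T" "k < r" for i k
    using msg that by (auto simp: message_blocks_def bij_betw_def K_def)
  have msg_cases: "\<exists>i k. i < T \<and> k < r \<and> c = msg i k" if "c < K" for c
  proof -
    have "c \<in> (\<lambda>(i, k). msg i k) ` ({..<T} \<times> {..<r})"
      using msg that by (simp add: message_blocks_def bij_betw_def K_def)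
    then show ?thesis
      by auto
  qed
  \<comment> \<open>In type C, subtracting \<open>C1\<close> turns the diagonal entry 1 + 1 at a
    fixed point into 1, so all entries are 0 or 1 in any characteristic.\<close>
  have G_entry: "G $$ (a, msg i k) =
      (case kind i of TypeA \<Rightarrow> if a = k then 1 else 0 | TypeB \<Rightarrow> if a = \<sigma> k then 1 else 0
       | TypeC \<Rightarrow> if a = k \<or> a = \<sigma> k then 1 else 0)"
    if "i < T" "a < r" "k < r" for i a k
  proof -
    have "G $$ (a, msg i k) = block_submatrix r msg i G $$ (a, k)"
      using that by (simp add: block_submatrix_def)
    also have "\<dots> = (case kind i of TypeA \<Rightarrow> if a = k then 1 else 0 | TypeB \<Rightarrow> if a = \<sigma> k then 1 else 0
       | TypeC \<Rightarrow> if a = k \<or> a = \<sigma> k then 1 else 0)"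
      using that unfolding assms(7)[OF \<open>i < T\<close>]
      by (auto simp: Ceq permutation_matrix_def assms(5) fixed_columns_def split: block_type.split)
    finally show ?thesis .
  qed
  \<comment> \<open>Entrywise form of the fact that every block commutes with \<open>C\<close>. In
    \<open>CG\<close> it trades the row permutation for a column permutation inside the
    blocks.\<close>
  have G_\<sigma>: "G $$ (\<sigma> a, msg i (\<sigma> k)) = G $$ (a, msg i k)" if "i < T" "a < r" "k < r" for i a k
    using that by (auto simp: G_entry \<sigma>r \<sigma>inj \<sigma>\<sigma> split: block_type.split)
  have CG: "(C * G) $$ (a, msg i (\<sigma> k)) = G $$ (a, msg i k)" if "i < T" "a < r" "k < r" for i a k
    using permutation_matrix_mult_index[OF \<sigma> Gc, of "\<sigma> a" "msg i (\<sigma> k)"] that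
    by (simp add: \<sigma>r \<sigma>\<sigma> msgK G_\<sigma> Ceq)

  have "\<exists>a<r. G $$ (a, demand F t) = 1 \<and> (\<forall>c<K. F $$ (t, c) = Sym0 \<longrightarrow> G $$ (a, c) = 0)"
    if t: "t < L" for t
  proof -
    let ?S = "insert (demand F t) (side_info F t)"
    from ABC_decoding_row[OF assms(4) \<sigma> \<sigma>\<sigma> t] obtain a where a: "a < r"
      and A: "\<And>j. j \<in> blocks T kind TypeA \<Longrightarrow> msg j a \<in> ?S"
      and B: "\<And>j. j \<in> blocks T kind TypeB \<Longrightarrow> msg j (\<sigma> a) \<in> ?S"
      and C: "\<And>j. j \<in> blocks T kind TypeC \<Longrightarrow> {msg j a, msg j (\<sigma> a)} \<subseteq> ?S"
      and d: "\<exists>i k. demand F t = msg i k \<and> i < T \<and> k < r \<and>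
       (case kind i of TypeA \<Rightarrow> k = a | TypeB \<Rightarrow> k = \<sigma> a | TypeC \<Rightarrow> k = a \<or> k = \<sigma> a)"
      by blast
    have "G $$ (a, demand F t) = 1"
    proof -
      obtain i k where "demand F t = msg i k" "i < T" "k < r"
        "case kind i of TypeA \<Rightarrow> k = a | TypeB \<Rightarrow> k = \<sigma> a | TypeC \<Rightarrow> k = a \<or> k = \<sigma> a"
        using d by blast
      then show ?thesis
        using a by (cases "kind i") (auto simp: G_entry \<sigma>\<sigma>)
    qed
    moreover have "G $$ (a, c) = 0" if c: "c < K" and F0: "F $$ (t, c) = Sym0" for c
    proof -
      obtain j k where jk: "j < T" "k < r" "c = msg j k"
        using msg_cases[OF c] by blast
      \<comment> \<open>\<open>Sym0\<close> differs both from the symbol at the demand and from that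
        of side information.\<close>
      have nin: "msg j k \<notin> ?S"
        using F0 fitting_matrix_demand(2)[OF F t] by (auto simp: jk side_info_def)
      show ?thesis
      proof (cases "kind j")
        case TypeA
        then have "a \<noteq> k"
          using A[of j] nin jk by (auto simp: blocks_def)
        then show ?thesis
          using jk a TypeA by (simp add: G_entry)
      next
        case TypeB
        then have "a \<noteq> \<sigma> k"
          using B[of j] nin jk by (auto simp: blocks_def \<sigma>\<sigma>)
        then show ?thesis
          using jk a TypeB by (simp add: G_entry)
      next
        case TypeC
        then have "a \<noteq> k" "a \<noteq> \<sigma> k"
          using C[of j] nin jk by (auto simp: blocks_def \<sigma>\<sigma>)
        then show ?thesis
          using jk a TypeC by (simp add: G_entry)
      qed
    qed
    ultimately show ?thesis
      using a by blast
  qed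
  then obtain a where a: "\<And>t. t < L \<Longrightarrow> a t < r" "\<And>t. t < L \<Longrightarrow> G $$ (a t, demand F t) = 1"
    "\<And>t c. t < L \<Longrightarrow> c < K \<Longrightarrow> F $$ (t, c) = Sym0 \<Longrightarrow> G $$ (a t, c) = 0"
    by metis
  \<comment> \<open>Row \<open>t\<close> of \<open>D\<close> is the unit vector at
    \<open>a t\<close>, so multiplying by \<open>D\<close> selects row \<open>a t\<close>; this is
    used for \<open>G\<close> and for \<open>C * G\<close>.\<close>
  define D :: "'a mat" where "D = mat L r (\<lambda>(t, b). if b = a t then 1 else 0)"
  have Dc: "D \<in> carrier_mat L r"
    by (simp add: D_def)
  have D_mult: "(D * H) $$ (t, c) = H $$ (a t, c)"
    if "H \<in> carrier_mat r K" "t < L" "c < K" for H t c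
  proof -
    have "(D * H) $$ (t, c) = (\<Sum>b<r. (if b = a t then 1 else 0) * H $$ (b, c))"
      using that by (auto simp: D_def scalar_prod_def atLeast0LessThan intro!: sum.cong)
    also have "\<dots> = (\<Sum>b<r. if b = a t then H $$ (b, c) else 0)"
      by (intro sum.cong) auto
    also have "\<dots> = H $$ (a t, c)"
      using a(1) that by simp
    finally show ?thesis .
  qed
  have CGc: "C * G \<in> carrier_mat r K"
    using Cc Gc by simp
  have M0: "(D * G) $$ (t, c) = 0" if "t < L" "c < K" "F $$ (t, c) = Sym0" for t c
    using that a(3) by (simp add: D_mult[OF Gc])
  have M1: "(D * G) $$ (t, c) = 1" if "t < L" "c < K" "F $$ (t, c) = Sym1" for t c
    using that a(2)[of t] fitting_matrix_demand(3)[OF F, of t c] by (simp add: D_mult[OF Gc])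
  have M: "D * G \<in> completions F"
    using M0 M1 Dc Gc Fc by (simp add: completions_def)

  have Pc: "P \<in> carrier_mat L K"
    and P: "\<And>i k. i < T \<Longrightarrow> k < r \<Longrightarrow> col P (msg i (\<sigma> k)) = col F (msg i k)"
    using assms(8) Fc by (auto simp: block_permuted_def)
  have Bc: "B \<in> carrier_mat L K"
    using Pc by (simp add: assms(9))
  have B1: "B $$ (t, c) \<noteq> Sym1" if "t < L" "c < K" for t c
    using that Pc by (auto simp: assms(9) one_to_X_def)
  \<comment> \<open>\<open>C * G\<close> and \<open>P\<close> arise from \<open>G\<close> and
    \<open>F\<close> by the same column permutation, and \<open>one_to_X\<close> creates no new
    \<open>Sym0\<close>. As \<open>B\<close> has no \<open>Sym1\<close>, these zeros are all that a
    completion of \<open>B\<close> must satisfy.\<close>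
  have N0: "(D * (C * G)) $$ (t, c) = 0" if t: "t < L" and c: "c < K" and B0: "B $$ (t, c) = Sym0" for t c
  proof -
    obtain i k where ik: "i < T" "k < r" "c = msg i (\<sigma> k)"
      using msg_cases[OF c] \<sigma>\<sigma> \<sigma>r by metis
    have "P $$ (t, c) = Sym0"
      using B0 t c Pc by (simp add: assms(9) one_to_X_def split: if_splits)
    moreover have "P $$ (t, c) = F $$ (t, msg i k)"
      using arg_cong[OF P[OF ik(1,2)], of "\<lambda>v. v $ t"] ik t c Pc Fc msgK by simp
    ultimately show ?thesis
      using t c ik a by (simp add: D_mult[OF CGc] CG msgK)
  qed

  have ext: "fitting_matrix (2 * L) (2 * K) Fext"
    unfolding assms(10) by (rule fitting_matrix_four_block[OF F Bc B1])
  have Fextc: "Fext \<in> carrier_mat (2 * L) (2 * K)"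
    using ext by (simp add: fitting_matrix_def)
  have dims: "dim_col G = K" "dim_col (C * G) = K"
    using Gc by auto
  let ?G = "append_cols G (C * G)"
  \<comment> \<open>\<open>D\<close> stacked on \<open>D * C\<close>, with right blocks of width 0
    that match the lower blocks of height 0 in \<open>append_cols\<close> under block
    multiplication.\<close>
  define D' where "D' = four_block_mat D (0\<^sub>m L 0) (D * C) (0\<^sub>m L 0)"
  have D'c: "D' \<in> carrier_mat (2 * L) r"
    using Dc Cc by (auto simp: D'_def)
  have G'c: "?G \<in> carrier_mat r (2 * K)"
    using four_block_carrier_mat[OF Gc zero_carrier_mat[of 0 K]]
    unfolding append_cols_def dims by (simp add: mult_2)
  have DC: "D * C \<in> carrier_mat L r"
    using Dc Cc by simp
  \<comment> \<open>The involution makes the lower right block of the product equal to the upper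
    left one.\<close>
  have "C * (C * G) = G"
    using assoc_mult_mat[OF Cc Cc Gc] Gc by (simp add: CC)
  then have DCCG: "D * C * (C * G) = D * G"
    using assoc_mult_mat[OF Dc Cc CGc] by simp
  have DCG: "D * C * G = D * (C * G)"
    by (rule assoc_mult_mat[OF Dc Cc Gc])
  have zero: "0\<^sub>m L 0 * 0\<^sub>m 0 K = (0\<^sub>m L K :: 'a mat)"
    by (intro eq_matI) (auto simp: scalar_prod_def)
  have "D * G \<in> carrier_mat L K" "D * (C * G) \<in> carrier_mat L K"
    using Dc Gc CGc by auto
  then have "D' * ?G = four_block_mat (D * G) (D * (C * G)) (D * (C * G)) (D * G)"
    unfolding D'_def append_cols_def dims
    unfolding mult_four_block_mat[OF Dc zero_carrier_mat DC zero_carrier_mat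
        Gc CGc zero_carrier_mat zero_carrier_mat]
    by (simp add: zero DCG DCCG)
  then have M': "D' * ?G \<in> completions Fext"
    using D'c G'c Fextc Dc Gc Cc CGc Fc Bc M0 M1 N0 B1
    by (auto simp: completions_def assms(10) index_mat_four_block)
  have code: "index_code Fext r ?G"
    by (rule index_code_of_completion[OF ext D'c G'c M'])
  show ?thesis
  proof (intro conjI impI code)
    assume opt: "optimal_index_code F r G"
    have "r \<le> r'" if "index_code Fext r' (G' :: 'a mat)" for r' G'
    proof -
      obtain H :: "'a mat" where "index_code F r' H"
        using index_code_four_block_left F ext \<open>index_code Fext r' G'\<close> unfolding assms(10) by blast
      then show ?thesis
        using opt by (auto simp: optimal_index_code_def)
    qed
    then show opt': "optimal_index_code Fext r ?G"
      using code by (auto simp: optimal_index_code_def)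
    \<comment> \<open>Both problems have an optimal code of the same length \<open>r\<close> that
      factors a completion, so all four quantities equal \<open>r\<close>.\<close>
    show "rank_invariant TYPE('a) F Fext"
      using optimal_factored_completion[OF F opt Dc M] optimal_factored_completion[OF ext opt' D'c M']
      by (simp add: rank_invariant_def)
    have "\<exists>I \<subseteq> {..<2 * L}. \<exists>J \<subseteq> {..<2 * K}. submatrix Fext I J = F"
    proof (intro exI conjI)
      show "submatrix Fext {..<L} {..<K} = F"
        unfolding assms(10) by (rule submatrix_four_block_upper_left[OF Fc])
    qed auto
    then show "two_order_extension F Fext"
      using F ext Fc Fextc by (simp add: two_order_extension_def ic_extension_def)
  qed
qed

end
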